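(* Let $S$ be a $*$-monoid, let $a,b,c\in S$ and $k\in\mathbb{N}$. Then $a$ is $(b,c)$-core-EP invertible with $k\in {\rm I}_{(b,c)}(a)$ if and only if $a$ is left $((ca)^kb,c)$-invertible and $(ca)^kc$ is $\{1,3\}$-invertible with $abr\in (ca)^kc\{1,3\}$ for some $r\in S$.
   Context: $\mathbb{N}=\{0,1,2,\dots\}$. A $*$-monoid is a monoid $S$ with unity $1$ and an involution $*:S\to S$ satisfying $(a^* )^*=a$ and $(ab)^*=b^*a^*$. $u\mathrel{\mathcal R}v$ iff $uS=vS$; $u\mathrel{\mathcal L}v$ iff $Su=Sv$. $a$ is $(b,c)$-core-EP invertible if there exist $x\in S$ and $k\in\mathbb{N}$ such that $cax(ca)^{k}c=(ca)^{k}c$, $x\mathrel{\mathcal R}(ca)^{k}b$ and $x\mathrel{\mathcal L}((ca)^{k}c)^{*}$. ${\rm I}_{(b,c)}(a)$ is the set of all $k\in\mathbb{N}$ for which such an $x$ exists. For $u,v,w\in S$, $u$ is left $(v,w)$-invertible if $v\in Swuv$ (equivalently, there is $x\in Sw$ with $v=xuv$). A $\{1,3\}$-inverse of $u\in S$ is $y\in S$ with $uyu=u$ and $(uy)^*=uy$; $u\{1,3\}$ denotes the set of all $\{1,3\}$-inverses of $u$, and $u$ is $\{1,3\}$-invertible if this set is nonempty. *)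

theory Defs
  imports Main
begin

class star_monoid = monoid_mult +
  fixes adj :: "'a \<Rightarrow> 'a"  (\<open>(_\<^sup>\<star>)\<close> [1000] 999)
  assumes adj_adj: "(x\<^sup>\<star>)\<^sup>\<star> = x"
    and adj_mult: "(x * y)\<^sup>\<star> = y\<^sup>\<star> * x\<^sup>\<star>"

definition right_ideal :: "'a::monoid_mult \<Rightarrow> 'a set" where
  "right_ideal u = range (\<lambda>s. u * s)"

definition left_ideal :: "'a::monoid_mult \<Rightarrow> 'a set" where
  "left_ideal u = range (\<lambda>s. s * u)"

definition green_R :: "'a::monoid_mult \<Rightarrow> 'a \<Rightarrow> bool"  (infix \<open>\<R>\<close> 50) where
  "u \<R> v \<longleftrightarrow> right_ideal u = right_ideal v"

definition green_L :: "'a::monoid_mult \<Rightarrow> 'a \<Rightarrow> bool"  (infix \<open>\<L>\<close> 50) where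
  "u \<L> v \<longleftrightarrow> left_ideal u = left_ideal v"

(* Argument order: the pair comes first. core_EP_invertible b c a says that a is
   (b,c)-core-EP invertible, and left_invertible_along v w u that u is left (v,w)-invertible. *)
definition is_core_EP_inverse ::
    "'a::star_monoid \<Rightarrow> 'a \<Rightarrow> 'a \<Rightarrow> nat \<Rightarrow> 'a \<Rightarrow> bool" where
  "is_core_EP_inverse b c a k x \<longleftrightarrow>
     c * a * x * (c * a) ^ k * c = (c * a) ^ k * c \<and>
     x \<R> (c * a) ^ k * b \<and>
     x \<L> ((c * a) ^ k * c)\<^sup>\<star>"

definition core_EP_invertible :: "'a::star_monoid \<Rightarrow> 'a \<Rightarrow> 'a \<Rightarrow> bool" where
  "core_EP_invertible b c a \<longleftrightarrow> (\<exists>x k. is_core_EP_inverse b c a k x)"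

definition core_EP_indices :: "'a::star_monoid \<Rightarrow> 'a \<Rightarrow> 'a \<Rightarrow> nat set" where
  "core_EP_indices b c a = {k. \<exists>x. is_core_EP_inverse b c a k x}"

definition left_invertible_along :: "'a::monoid_mult \<Rightarrow> 'a \<Rightarrow> 'a \<Rightarrow> bool" where
  "left_invertible_along v w u \<longleftrightarrow> v \<in> left_ideal (w * u * v)"

definition inverses_13 :: "'a::star_monoid \<Rightarrow> 'a set" where
  "inverses_13 u = {y. u * y * u = u \<and> (u * y)\<^sup>\<star> = u * y}"

definition invertible_13 :: "'a::star_monoid \<Rightarrow> bool" where
  "invertible_13 u \<longleftrightarrow> inverses_13 u \<noteq> {}"

end

theory Submission
  imports Defs
begin

text \<open>
  Put \<open>v = (ca)\<^sup>kb\<close> and \<open>m = (ca)\<^sup>kc\<close>, so that \<open>cav = mab\<close>. If \<open>x\<close> is a core-EP inverse,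
  then \<open>x \<in> Sm\<^sup>*\<close> and \<open>caxm = m\<close> give \<open>x = x(cax)\<^sup>*\<close>; hence \<open>cax\<close> is Hermitian, \<open>x = xcax\<close>,
  and \<open>v \<in> xS\<close> gives \<open>v = xcav\<close>. Writing \<open>x = vr\<close> makes \<open>cax = m(abr)\<close>.
  Conversely, given \<open>v = tcav\<close> and \<open>r\<close>, the element \<open>x = vr\<close> is a core-EP inverse:
  \<open>cax = m(abr)\<close> is Hermitian and fixes \<open>m\<close>, so \<open>x = t(cax)\<^sup>* \<in> Sm\<^sup>*\<close>, \<open>m\<^sup>* = m\<^sup>*cax \<in> Sx\<close>
  and \<open>v = tmab = tcaxmab = xmab \<in> xS\<close>.
\<close>

lemma self_in_right_ideal: "u \<in> right_ideal u"
  unfolding right_ideal_def by (metis mult_1_right rangeI)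

lemma self_in_left_ideal: "u \<in> left_ideal u"
  unfolding left_ideal_def by (metis mult_1_left rangeI)

lemma right_ideal_mult_subset: "right_ideal (v * s) \<subseteq> right_ideal v"
  by (auto simp: right_ideal_def mult.assoc)

lemma left_ideal_mult_subset: "left_ideal (s * v) \<subseteq> left_ideal v"
  by (auto simp: left_ideal_def mult.assoc[symmetric])

text \<open>Each element lies in its own ideal because of the unity, so equal ideals amount to
  mutual divisibility, which supplies explicit factors.\<close>

lemma green_R_iff: "u \<R> v \<longleftrightarrow> (\<exists>s. u = v * s) \<and> (\<exists>t. v = u * t)"
proof
  assume "u \<R> v"
  then have "u \<in> right_ideal v" "v \<in> right_ideal u"
    using self_in_right_ideal by (auto simp: green_R_def)
  then show "(\<exists>s. u = v * s) \<and> (\<exists>t. v = u * t)"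
    by (auto simp: right_ideal_def)
next
  assume "(\<exists>s. u = v * s) \<and> (\<exists>t. v = u * t)"
  then show "u \<R> v"
    unfolding green_R_def using right_ideal_mult_subset by (metis subset_antisym)
qed

lemma green_L_iff: "u \<L> v \<longleftrightarrow> (\<exists>s. u = s * v) \<and> (\<exists>t. v = t * u)"
proof
  assume "u \<L> v"
  then have "u \<in> left_ideal v" "v \<in> left_ideal u"
    using self_in_left_ideal by (auto simp: green_L_def)
  then show "(\<exists>s. u = s * v) \<and> (\<exists>t. v = t * u)"
    by (auto simp: left_ideal_def)
next
  assume "(\<exists>s. u = s * v) \<and> (\<exists>t. v = t * u)"
  then show "u \<L> v"
    unfolding green_L_def using left_ideal_mult_subset by (metis subset_antisym)
qed

lemma power_mult_shift:
  fixes a b c :: "'a::monoid_mult"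
  shows "c * a * ((c * a) ^ k * b) = (c * a) ^ k * c * (a * b)"
proof -
  have "c * a * ((c * a) ^ k * b) = (c * a) * (c * a) ^ k * b"
    by (simp only: mult.assoc)
  also have "\<dots> = (c * a) ^ k * (c * a) * b"
    by (simp only: power_commutes)
  finally show ?thesis
    by (simp only: mult.assoc)
qed

text \<open>Taking adjoints in \<open>p * x * m = m\<close> shows that
  \<open>(p * x)\<^sup>\<star>\<close> fixes \<open>m\<^sup>\<star>\<close> from the right, hence
  also its left multiple \<open>x\<close>. So \<open>p * x\<close> has the form
  \<open>q * q\<^sup>\<star>\<close>. Applied with \<open>p = c * a\<close>.\<close>

lemma hermitian_of_left_factor:
  fixes p x m :: "'a::star_monoid"
  assumes "p * x * m = m" and "x = s * m\<^sup>\<star>"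
  shows "(p * x)\<^sup>\<star> = p * x" and "x * p * x = x"
proof -
  have "m\<^sup>\<star> = m\<^sup>\<star> * (p * x)\<^sup>\<star>"
    using assms(1) by (metis adj_mult)
  then have x: "x * (p * x)\<^sup>\<star> = x"
    using assms(2) by (metis mult.assoc)
  have "(p * x) * (p * x)\<^sup>\<star> = p * x"
    by (simp only: mult.assoc[of p] x)
  then show herm: "(p * x)\<^sup>\<star> = p * x"
    by (metis adj_adj adj_mult)
  show "x * p * x = x"
    using x by (simp only: herm mult.assoc)
qed

lemma core_EP_inverse_imp:
  fixes a b c :: "'a::star_monoid"
  assumes "is_core_EP_inverse b c a k x"
  shows "left_invertible_along ((c * a) ^ k * b) c a"
    and "\<exists>r. a * b * r \<in> inverses_13 ((c * a) ^ k * c)"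
proof -
  define v where "v = (c * a) ^ k * b"
  define m where "m = (c * a) ^ k * c"
  have cav: "c * a * v = m * (a * b)"
    unfolding v_def m_def by (rule power_mult_shift)
  have xm: "c * a * x * m = m" and "x \<R> v" and "x \<L> m\<^sup>\<star>"
    using assms unfolding is_core_EP_inverse_def v_def m_def by (simp_all add: mult.assoc)
  then obtain r t s where r: "x = v * r" and t: "v = x * t" and s: "x = s * m\<^sup>\<star>"
    unfolding green_R_iff green_L_iff by blast
  note herm = hermitian_of_left_factor[OF xm s]
  \<comment> \<open>As \<open>v\<close> is a right multiple of \<open>x\<close>, it inherits the
    identity \<open>x * (c * a) * x = x\<close>.\<close>
  have "x * (c * a * v) = x * (c * a) * x * t"
    by (simp only: t mult.assoc)
  then have "v = x * (c * a * v)"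
    by (simp only: herm(2) t[symmetric])
  then show "left_invertible_along ((c * a) ^ k * b) c a"
    unfolding left_invertible_along_def left_ideal_def v_def by blast
  have "m * (a * b * r) = c * a * x"
    using arg_cong[OF cav, of "\<lambda>z. z * r"] by (simp only: r mult.assoc)
  then have "a * b * r \<in> inverses_13 m"
    using xm herm(1) by (simp add: inverses_13_def)
  then show "\<exists>r. a * b * r \<in> inverses_13 ((c * a) ^ k * c)"
    unfolding m_def by blast
qed

text \<open>Left invertibility allows \<open>c * a\<close> to be cancelled in front of
  \<open>v\<close> and its right multiples, so facts about \<open>c * a * x\<close> descend to
  \<open>x\<close>.\<close>

lemma core_EP_inverse_of_inverse_13:
  fixes a b c :: "'a::star_monoid"
  assumes "left_invertible_along ((c * a) ^ k * b) c a"
    and "a * b * r \<in> inverses_13 ((c * a) ^ k * c)"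
  shows "is_core_EP_inverse b c a k ((c * a) ^ k * b * r)"
proof -
  define v where "v = (c * a) ^ k * b"
  define m where "m = (c * a) ^ k * c"
  define x where "x = v * r"
  have cav: "c * a * v = m * (a * b)"
    unfolding v_def m_def by (rule power_mult_shift)
  obtain t where t: "v = t * (c * a * v)"
    using assms(1) unfolding left_invertible_along_def left_ideal_def v_def by blast
  have cax: "c * a * x = m * (a * b * r)"
    using arg_cong[OF cav, of "\<lambda>z. z * r"] by (simp only: x_def mult.assoc)
  have xm: "c * a * x * m = m" and herm: "(c * a * x)\<^sup>\<star> = c * a * x"
    using assms(2) unfolding cax by (simp_all add: inverses_13_def m_def)
  have tx: "x = t * (c * a * x)"
    unfolding x_def using arg_cong[OF t, of "\<lambda>z. z * r"] by (simp only: mult.assoc)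
  \<comment> \<open>Expanding \<open>m\<close> to \<open>c * a * x * m\<close> creates the factor
    \<open>c * a * x\<close>, which \<open>t\<close> turns into \<open>x\<close>.\<close>
  have "v = t * (c * a * x * m * (a * b))"
    using t by (simp only: cav xm)
  also have "\<dots> = t * (c * a * x) * (m * (a * b))"
    by (simp only: mult.assoc)
  finally have "v = x * (m * (a * b))"
    by (simp only: tx[symmetric])
  moreover have "x = v * r"
    by (fact x_def)
  ultimately have R: "x \<R> v"
    unfolding green_R_iff by blast
  \<comment> \<open>Being Hermitian, \<open>c * a * x\<close> equals the adjoint of
    \<open>m * (a * b * r)\<close>, which ends in \<open>m\<^sup>\<star>\<close>.\<close>
  have "x = t * (a * b * r)\<^sup>\<star> * m\<^sup>\<star>"
    using tx by (metis herm cax adj_mult mult.assoc)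
  moreover have "m\<^sup>\<star> = m\<^sup>\<star> * (c * a * x)"
    using adj_mult[of "c * a * x" m] by (simp only: xm herm)
  then have "m\<^sup>\<star> = m\<^sup>\<star> * (c * a) * x"
    by (simp only: mult.assoc)
  ultimately have "x \<L> m\<^sup>\<star>"
    unfolding green_L_iff by blast
  with R xm show ?thesis
    unfolding is_core_EP_inverse_def x_def v_def m_def by (simp add: mult.assoc)
qed

theorem theorem3p19:
  fixes a b c :: "'a::star_monoid" and k :: nat
  shows "(core_EP_invertible b c a \<and> k \<in> core_EP_indices b c a) \<longleftrightarrow>
    (left_invertible_along ((c * a) ^ k * b) c a \<and>
     invertible_13 ((c * a) ^ k * c) \<and>
     (\<exists>r. a * b * r \<in> inverses_13 ((c * a) ^ k * c)))"
proof
  assume "core_EP_invertible b c a \<and> k \<in> core_EP_indices b c a"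
  then obtain x where "is_core_EP_inverse b c a k x"
    by (auto simp: core_EP_indices_def)
  from core_EP_inverse_imp[OF this] show "left_invertible_along ((c * a) ^ k * b) c a \<and>
     invertible_13 ((c * a) ^ k * c) \<and>
     (\<exists>r. a * b * r \<in> inverses_13 ((c * a) ^ k * c))"
    unfolding invertible_13_def by blast
next
  assume "left_invertible_along ((c * a) ^ k * b) c a \<and>
     invertible_13 ((c * a) ^ k * c) \<and>
     (\<exists>r. a * b * r \<in> inverses_13 ((c * a) ^ k * c))"
  then obtain x where "is_core_EP_inverse b c a k x"
    using core_EP_inverse_of_inverse_13 by blast
  then show "core_EP_invertible b c a \<and> k \<in> core_EP_indices b c a"
    unfolding core_EP_invertible_def core_EP_indices_def by blast
qed

end
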